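(* Let $a$ be a fixed real constant. Then the sequence $\{n^a\}_{n\ge 1}$ is not a strong Benford sequence.
   Context: Strong Benford: Every positive real $x$ is written $x=10^{M}\sum_{j\ge 0} d_j 10^{-j}$ with $M\in\mathbb{Z}$, $1\le d_0\le 9$, $0\le d_j\le 9$ for $j\ge 1$ (usual convention: the digits are not eventually all $9$); the $d_j$ are the digits of $x$. A sequence $\{a_k\}_{k\ge1}$ of positive reals is strong Benford if for every positive integer $K$ and every digit string $S=d_0d_1\cdots d_{K-1}$ with $d_0\ne 0$, $$\lim_{N\to\infty}\frac{\#\{k\le N: \text{the first } K \text{ digits of } a_k \text{ are } d_0,\dots,d_{K-1}\}}{N}=\log_{10}(r+10^{-K+1})-\log_{10} r,\qquad r=\sum_{j=0}^{K-1}d_j10^{-j}.$$ *)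

theory Defs
  imports Complex_Main
begin

definition decimal_expansion :: "real \<Rightarrow> int \<Rightarrow> (nat \<Rightarrow> nat) \<Rightarrow> bool" where
  "decimal_expansion x M d \<longleftrightarrow>
     1 \<le> d 0 \<and> (\<forall>j. d j \<le> 9) \<and> \<not> (\<forall>\<^sub>F j in sequentially. d j = 9) \<and>
     x = 10 powi M * (\<Sum>j. real (d j) * 10 powi (- int j))"

text \<open>The expansion of a positive real is unique, so the existential quantifier below just
  selects it; a nonpositive real has no expansion and hence no leading digits.\<close>

definition has_first_digits :: "real \<Rightarrow> nat list \<Rightarrow> bool" where
  "has_first_digits x S \<longleftrightarrow>
     (\<exists>M d. decimal_expansion x M d \<and> (\<forall>j < length S. d j = S ! j))"

text \<open>Sequences are indexed from 1: the value at 0 plays no role. The digit string is the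
  list \<open>S\<close>, of length \<open>K\<close>. The definition is meant for sequences of positive reals.\<close>

definition strong_benford :: "(nat \<Rightarrow> real) \<Rightarrow> bool" where
  "strong_benford a \<longleftrightarrow>
     (\<forall>K S. K > 0 \<and> length S = K \<and> (\<forall>j < K. S ! j \<le> 9) \<and> S ! 0 \<noteq> 0 \<longrightarrow>
        (let r = (\<Sum>j<K. real (S ! j) * 10 powi (- int j)) in
         (\<lambda>N. real (card {k \<in> {1..N}. has_first_digits (a k) S}) / real N)
           \<longlonglongrightarrow> log 10 (r + 10 powi (- int K + 1)) - log 10 r))"

end

theory Submission
  imports Defs
begin

text \<open>If \<open>a \<noteq> 0\<close>, the indices \<open>k\<close> for which \<open>k powr a\<close> lies between \<open>3\<close> and \<open>9\<close> times some power of
  ten form arbitrarily late gaps in the set of indices with first digit \<open>1\<close>, and the endpoints of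
  these gaps have a ratio bounded away from \<open>1\<close>. The counting function is constant
  along a gap while the length of the initial segment grows by a fixed factor, so the frequency of
  the first digit \<open>1\<close> can only converge to \<open>0\<close>, whereas a strong Benford sequence has
  frequency \<open>log 10 2\<close>.\<close>

text \<open>The digits after \<open>d 0\<close> contribute at least 0 and at most 9/10 + 9/100 + ...
  = 1. The upper bound is left non-strict; the margins chosen in \<open>first_digit_not_one\<close>
  absorb this.\<close>

lemma decimal_expansion_bounds:
  assumes "decimal_expansion x M d"
  shows "real (d 0) * 10 powi M \<le> x" "x \<le> (real (d 0) + 1) * 10 powi M"
proof -
  define f where "f j = real (d j) * 10 powi (- int j)" for j
  have x: "x = 10 powi M * suminf f" and d9: "d j \<le> 9" for j
    using assms by (auto simp: decimal_expansion_def f_def[abs_def])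
  have f_alt: "f j = real (d j) * (1/10) ^ j" for j
    by (simp add: f_def power_int_minus power_int_of_nat power_one_over divide_simps)
  have f_le: "f j \<le> 9 * (1/10) ^ j" for j
    unfolding f_alt using d9[of j] by (intro mult_right_mono) auto
  have f_nonneg: "f j \<ge> 0" for j
    by (simp add: f_alt)
  have geo: "(\<lambda>j. 9 * (1/10::real) ^ Suc j) sums 1"
    using sums_mult[OF geometric_sums[of "1/10::real"], of "9/10"] by simp
  have "summable (\<lambda>j. f (Suc j))"
    by (rule summable_comparison_test'[OF sums_summable[OF geo]])
      (use f_le f_nonneg in \<open>simp del: power_Suc\<close>)
  then have smf: "summable f"
    by (simp add: summable_Suc_iff)
  have split: "suminf f = real (d 0) + (\<Sum>j. f (Suc j))"
    using suminf_split_head[OF smf] by (simp add: f_alt)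
  have "(\<Sum>j. f (Suc j)) \<ge> 0"
    using \<open>summable (\<lambda>j. f (Suc j))\<close> f_nonneg by (intro suminf_nonneg)
  with split show "real (d 0) * 10 powi M \<le> x"
    by (simp add: x mult.commute)
  have "(\<Sum>j. f (Suc j)) \<le> (\<Sum>j. 9 * (1/10::real) ^ Suc j)"
    using f_le \<open>summable (\<lambda>j. f (Suc j))\<close> sums_summable[OF geo] by (intro suminf_le)
  with split sums_unique[OF geo] show "x \<le> (real (d 0) + 1) * 10 powi M"
    by (simp add: x mult.commute)
qed

text \<open>A number with first digit 1 lies between \<open>10 powi M\<close> and
  \<open>2 * 10 powi M\<close>. If \<open>M \<le> m\<close> it is too small, since 2 < 3; otherwise
  \<open>M \<ge> m + 1\<close> and it is too large, since 10 > 9.\<close>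

lemma first_digit_not_one:
  assumes "3 * 10 powi m \<le> x" "x \<le> 9 * 10 powi m"
  shows "\<not> has_first_digits x [1]"
proof
  assume "has_first_digits x [1]"
  then obtain M d where "decimal_expansion x M d" "d 0 = 1"
    by (auto simp: has_first_digits_def)
  then have M: "10 powi M \<le> x" "x \<le> 2 * 10 powi M"
    using decimal_expansion_bounds[of x M d] by auto
  have pos: "(10::real) powi i > 0" for i
    by simp
  show False
  proof (cases "M \<le> m")
    case True
    then have "(10::real) powi M \<le> 10 powi m"
      by (intro power_int_increasing) auto
    with M assms pos[of m] show False by linarith
  next
    case False
    then have "(10::real) powi (m + 1) \<le> 10 powi M"
      by (intro power_int_increasing) auto
    then have "(10::real) * 10 powi m \<le> 10 powi M"
      by (simp add: power_int_add)
    with M assms pos[of m] show False by linarith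
  qed
qed

lemma nat_floor_ratio_tendsto_1:
  fixes x :: "nat \<Rightarrow> real"
  assumes "filterlim x at_top sequentially"
  shows "(\<lambda>i. real (nat \<lfloor>x i\<rfloor>) / x i) \<longlonglongrightarrow> 1"
proof (rule tendsto_sandwich)
  have ev: "\<forall>\<^sub>F i in sequentially. x i > 0"
    using assms by (simp add: filterlim_at_top_dense)
  show "\<forall>\<^sub>F i in sequentially. 1 - 1 / x i \<le> real (nat \<lfloor>x i\<rfloor>) / x i"
    using ev
  proof eventually_elim
    case (elim i)
    have "x i - 1 \<le> real (nat \<lfloor>x i\<rfloor>)"
      using elim by linarith
    then have "(x i - 1) / x i \<le> real (nat \<lfloor>x i\<rfloor>) / x i"
      using elim by (intro divide_right_mono) auto
    with elim show ?case by (simp add: diff_divide_distrib)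
  qed
  show "\<forall>\<^sub>F i in sequentially. real (nat \<lfloor>x i\<rfloor>) / x i \<le> 1"
    using ev by eventually_elim simp
  have "(\<lambda>i. 1 / x i) \<longlonglongrightarrow> 0"
    using assms by (intro real_tendsto_divide_at_top[OF tendsto_const])
  from tendsto_diff[OF tendsto_const this, of 1]
  show "(\<lambda>i. 1 - 1 / x i) \<longlonglongrightarrow> 1" by simp
qed simp

text \<open>No element of \<open>A\<close> is counted between \<open>m i\<close> and
  \<open>n i\<close>, so the frequency at \<open>n i\<close> is the one at \<open>m i\<close> times
  \<open>m i / n i\<close>. In the limit \<open>L * \<rho> = L\<close>.\<close>

lemma density_zero_if_gaps:
  fixes A :: "nat set" and L \<rho> :: real
  assumes lim: "(\<lambda>N. real (card {k \<in> {1..N}. k \<in> A}) / real N) \<longlonglongrightarrow> L"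
    and m: "filterlim m at_top sequentially"
    and mn: "\<And>i. m i \<le> n i"
    and gap: "\<And>i. A \<inter> {m i<..n i} = {}"
    and ratio: "(\<lambda>i. real (m i) / real (n i)) \<longlonglongrightarrow> \<rho>" "\<rho> \<noteq> 1"
  shows "L = 0"
proof -
  define g where "g N = real (card {k \<in> {1..N}. k \<in> A}) / real N" for N
  have n: "filterlim n at_top sequentially"
    by (rule filterlim_at_top_mono[OF m]) (simp add: mn)
  have gm: "(\<lambda>i. g (m i)) \<longlonglongrightarrow> L" and gn: "(\<lambda>i. g (n i)) \<longlonglongrightarrow> L"
    using filterlim_compose[OF lim m] filterlim_compose[OF lim n] by (simp_all add: g_def)
  have "\<forall>\<^sub>F i in sequentially. m i > 0"
    using m eventually_gt_at_top[of 0] by (simp add: filterlim_iff)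
  then have "\<forall>\<^sub>F i in sequentially. g (m i) * (real (m i) / real (n i)) = g (n i)"
  proof eventually_elim
    case (elim i)
    have "{k \<in> {1..m i}. k \<in> A} = {k \<in> {1..n i}. k \<in> A}"
      using gap[of i] mn[of i] by fastforce
    with elim show ?case by (simp add: g_def)
  qed
  from Lim_transform_eventually[OF tendsto_mult[OF gm ratio(1)] this]
  have "L * \<rho> = L" using gn LIMSEQ_unique by blast
  with ratio(2) show ?thesis by simp
qed

text \<open>Rounding the real endpoints down gives integer gaps whose endpoint ratio tends to
  \<open>u / v\<close>, which is below 1.\<close>

lemma density_zero_if_geometric_gaps:
  fixes u v q L :: real
  assumes lim: "(\<lambda>N. real (card {k \<in> {1..N}. k \<in> A}) / real N) \<longlonglongrightarrow> L"
    and "0 < u" "u < v" "1 < q"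
    and gap: "\<And>i k. u * q ^ i \<le> real k \<Longrightarrow> real k \<le> v * q ^ i \<Longrightarrow> k \<notin> A"
  shows "L = 0"
proof -
  define m n where "m i = nat \<lfloor>u * q ^ i\<rfloor>" and "n i = nat \<lfloor>v * q ^ i\<rfloor>" for i
  have x: "filterlim (\<lambda>i. c * q ^ i) at_top sequentially" if "c > 0" for c
    using that \<open>1 < q\<close>
    by (intro filterlim_tendsto_pos_mult_at_top[OF tendsto_const]
        filterlim_realpow_sequentially_gt1[THEN filterlim_at_infinity_imp_filterlim_at_top]) auto
  \<comment> \<open>Each floor is compared with its own argument, so that both inner quotients tend
    to 1; the powers of \<open>q\<close> then cancel.\<close>
  have "(\<lambda>i. (real (m i) / (u * q ^ i)) / (real (n i) / (v * q ^ i)) * (u / v)) \<longlonglongrightarrow> 1 / 1 * (u / v)"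
    unfolding m_def n_def using assms
    by (intro tendsto_intros nat_floor_ratio_tendsto_1 x) auto
  moreover have "(real (m i) / (u * q ^ i)) / (real (n i) / (v * q ^ i)) * (u / v) =
      real (m i) / real (n i)" for i
    using assms by (simp add: field_simps)
  ultimately have ratio: "(\<lambda>i. real (m i) / real (n i)) \<longlonglongrightarrow> u / v"
    by simp
  have "filterlim m at_top sequentially"
    unfolding m_def using \<open>0 < u\<close>
    by (intro filterlim_compose[OF filterlim_nat_sequentially]
        filterlim_compose[OF filterlim_floor_sequentially] x)
  moreover have "m i \<le> n i" for i
    unfolding m_def n_def using assms by (intro nat_mono floor_mono mult_right_mono) auto
  moreover have "A \<inter> {m i<..n i} = {}" for i
  proof -
    have "k \<notin> A" if "m i < k" "k \<le> n i" for k
    proof (rule gap[of i])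
      show "u * q ^ i \<le> real k"
        using that(1) unfolding m_def by linarith
      have "0 \<le> v * q ^ i" using assms by simp
      then show "real k \<le> v * q ^ i"
        using that(2) unfolding n_def by linarith
    qed
    then show ?thesis by auto
  qed
  ultimately show ?thesis
    using density_zero_if_gaps[OF lim _ _ _ ratio] assms by auto
qed

text \<open>With \<open>K = 1\<close> and \<open>r = 1\<close> the prescribed limit is
  \<open>log 10 (1 + 1) - log 10 1\<close>.\<close>

lemma strong_benford_first_digit_one:
  assumes "strong_benford a"
  shows "(\<lambda>N. real (card {k \<in> {1..N}. has_first_digits (a k) [1]}) / real N) \<longlonglongrightarrow> log 10 2"
  using assms[unfolded strong_benford_def, rule_format, of 1 "[1]"] by simp

lemma powr_first_digit_one_density_zero:
  fixes a L :: real
  assumes "a \<noteq> 0"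
    and lim: "(\<lambda>N. real (card {k \<in> {1..N}. has_first_digits (real k powr a) [1]}) / real N) \<longlonglongrightarrow> L"
  shows "L = 0"
proof -
  \<comment> \<open>For \<open>a < 0\<close> the map \<open>k powr a\<close> is decreasing, so 3 and
    9 change places to keep \<open>u < v\<close>. The absolute value in \<open>q\<close> makes the
    gaps move to infinity for either sign of \<open>a\<close>, while \<open>(q ^ i) powr a\<close>
    remains an integer power of ten.\<close>
  define u v q :: real where "u = (if a > 0 then 3 else 9) powr (1/a)"
    and "v = (if a > 0 then 9 else 3) powr (1/a)" and "q = 10 powr (1/\<bar>a\<bar>)"
  show ?thesis
  proof (rule density_zero_if_geometric_gaps[where A = "{k. has_first_digits (real k powr a) [1]}"])
    show "0 < u" by (simp add: u_def)
    show "u < v"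
      using \<open>a \<noteq> 0\<close> by (auto simp: u_def v_def intro: powr_less_mono2 powr_less_mono2_neg)
    show "1 < q" using \<open>a \<noteq> 0\<close> by (simp add: q_def)
    fix i k
    assume k: "u * q ^ i \<le> real k" "real k \<le> v * q ^ i"
    have pos: "0 < u * q ^ i" by (simp add: u_def q_def)
    with k have "0 < real k" by linarith
    have q_powr: "(q ^ i) powr a = 10 powi (if a > 0 then int i else - int i)"
    proof -
      have "(q ^ i) powr a = 10 powr (real i * (a / \<bar>a\<bar>))"
        by (simp add: q_def powr_powr powr_realpow[symmetric] mult_ac)
      also have "\<dots> = 10 powi (if a > 0 then int i else - int i)"
        using \<open>a \<noteq> 0\<close> by (simp add: powr_minus powr_realpow power_int_minus)
      finally show ?thesis .
    qed
    have uv: "(u * q ^ i) powr a = (if a > 0 then 3 else 9) * (q ^ i) powr a"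
      "(v * q ^ i) powr a = (if a > 0 then 9 else 3) * (q ^ i) powr a"
      using \<open>a \<noteq> 0\<close> by (simp_all add: u_def v_def powr_mult powr_powr q_def)
    define p where "p = (q ^ i) powr a"
    have "3 * p \<le> real k powr a \<and> real k powr a \<le> 9 * p"
    proof (cases "a > 0")
      case True
      with k pos uv show ?thesis
        using powr_mono2[of a "u * q ^ i" "real k"] powr_mono2[of a "real k" "v * q ^ i"]
        by (simp add: p_def)
    next
      case False
      with k pos uv \<open>0 < real k\<close> show ?thesis
        using powr_mono2'[of a "u * q ^ i" "real k"] powr_mono2'[of a "real k" "v * q ^ i"]
        by (simp add: p_def)
    qed
    then show "k \<notin> {k. has_first_digits (real k powr a) [1]}"
      using first_digit_not_one unfolding p_def q_powr by blast
  qed (use lim in simp)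
qed

theorem corollary1p3:
  fixes a :: real
  shows "\<not> strong_benford (\<lambda>n. real n powr a)"
proof
  assume "strong_benford (\<lambda>n. real n powr a)"
  note lim = strong_benford_first_digit_one[OF this]
  have log: "0 < log 10 (2::real)" "log 10 (2::real) < 1"
    by simp_all
  show False
  proof (cases "a = 0")
    case False
    with powr_first_digit_one_density_zero[OF _ lim] log show False by simp
  next
    case True
    \<comment> \<open>The sequence is constantly 1 here, so its frequency is 0 or 1 for every
      \<open>N > 0\<close>. Both values differ from \<open>log 10 2\<close>, hence the digits of 1
      need not be computed.\<close>
    define c :: real where "c = (if has_first_digits 1 [1] then 1 else 0)"
    have "real (card {k \<in> {1..N}. has_first_digits (real k powr a) [1]}) / real N = c"
      if "N > 0" for N
    proof -
      have "{k \<in> {1..N}. has_first_digits (real k powr a) [1]} =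
          (if has_first_digits 1 [1] then {1..N} else {})"
        using True by auto
      with that show ?thesis by (simp add: c_def)
    qed
    then have "\<forall>\<^sub>F N in sequentially.
        real (card {k \<in> {1..N}. has_first_digits (real k powr a) [1]}) / real N = c"
      using eventually_gt_at_top[of 0] by (rule eventually_mono[rotated])
    from Lim_transform_eventually[OF lim this] have "log 10 2 = c"
      by (simp add: LIMSEQ_const_iff)
    with log show False by (simp add: c_def split: if_splits)
  qed
qed

end
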